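(* Let $M>0$ and let $c_1,\dots,c_l>0$ be penalty parameters, $c_{\min}:=\min_j c_j$, where $c_{\min}$ is selected independently of $x$. Let $x\in\mathcal{X}$ and let $y\in\mathcal{C}_x$ be any feasible point. Suppose $$c_{\min}>\frac{L_f}{M\delta_g}.$$ Then every global minimizer of the penalized subproblem $$\min_{d\in\mathcal{D}}\ \nabla f_x(y)^\top d+\sum_{j=1}^l c_j\max\bigl(\langle d,\nabla g_{x,j}(y)\rangle,\,-M g_{x,j}(y)\bigr),$$ where $\mathcal{D}=\{d\in\mathbb{R}^n:\ \|d\|_2\le 1,\ \langle d,\nabla h_{x,i}(y)\rangle=0\ \ \forall i=1,\dots,m\}$, is optimal for the problem $$\min_{\|d\|_2\le 1}\ \nabla f_x(y)^\top d\quad\text{s.t.}\quad \nabla h_{x,i}(y)^\top d=0\ (i=1,\dots,m),\qquad \nabla g_{x,j}(y)^\top d\le -M\,g_{x,j}(y)\ (j=1,\dots,l).$$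
   Context: For each parameter $x\in\mathcal{X}$, where $\mathcal{X}\subseteq\mathbb{R}^p$ is compact, consider the problem $\min_{y\in\mathbb{R}^n} f_x(y)$ subject to $y\in\mathcal{C}_x:=\{y: g_x(y)\le 0,\ h_x(y)=0\}$, where $f_x:\mathbb{R}^n\to\mathbb{R}$, $h_x=(h_{x,1},\dots,h_{x,m})$ and $g_x=(g_{x,1},\dots,g_{x,l})$ are smooth (not necessarily convex). All gradients are with respect to $y$. Standing assumptions: (1) $\mathcal{C}_x$ is nonempty and closed, and for the given initial feasible point $y_0$ the sublevel set $\{y\in\mathcal{C}_x: f_x(y)\le f_x(y_0)\}$ is bounded. (2) At every feasible $y$, the vectors $\nabla h_{x,1}(y),\dots,\nabla h_{x,m}(y)$ are linearly independent. (3) (LICQ) At every local optimal point $y^*\in\mathcal{C}_x$, the vectors $\{\nabla h_{x,i}(y^* )\}_{i=1}^m\cup\{\nabla g_{x,j}(y^* ): g_{x,j}(y^* )=0\}$ are linearly independent. (4) There is a compact $Y\subseteq\mathbb{R}^n$ with $\mathcal{C}_x\subseteq Y$ for all $x\in\mathcal{X}$; $f_x,h_x,g_x$ are continuously differentiable in $y$ and $(x,y)\mapsto\nabla_y f_x(y)$, $(x,y)\mapsto\nabla_y g_x(y)$ are continuous on $\mathcal{X}\times Y$; $L_f,L_g>0$ are constants with $\|\nabla_y f_x(y)\|_2\le L_f$ and $\|\nabla_y g_x(y)\|_2\le L_g$ for all $x\in\mathcal{X}$, $y\in\mathcal{C}_x$. (5) $\delta_g>0$ is a constant such that for every $x\in\mathcal{X}$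 and every $y\in\mathcal{C}_x$, $\min_{j:\,g_{x,j}(y)<0}\bigl(-g_{x,j}(y)\bigr)\ge\delta_g$ (the minimum over an empty set being $+\infty$). *)

theory Defs
  imports "HOL-Analysis.Analysis"
begin

definition gradient :: "('a::real_inner \<Rightarrow> real) \<Rightarrow> 'a \<Rightarrow> 'a" where
  "gradient f y = (THE D. GDERIV f y :> D)"

definition continuously_differentiable :: "('a::real_inner \<Rightarrow> real) \<Rightarrow> bool" where
  "continuously_differentiable f \<longleftrightarrow>
     (\<forall>y. f differentiable (at y)) \<and> continuous_on UNIV (gradient f)"

text \<open>Independence of an indexed family: injectivity excludes repeated vectors, which the
  set-based predicate \<open>independent\<close> cannot see.\<close>
definition independent_family :: "'i set \<Rightarrow> ('i \<Rightarrow> 'a::real_vector) \<Rightarrow> bool" where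
  "independent_family I v \<longleftrightarrow> inj_on v I \<and> independent (v ` I)"

definition local_minimizer :: "('a::metric_space \<Rightarrow> real) \<Rightarrow> 'a set \<Rightarrow> 'a \<Rightarrow> bool" where
  "local_minimizer f S y \<longleftrightarrow> y \<in> S \<and> (\<exists>e>0. is_arg_min f (\<lambda>z. z \<in> S \<inter> ball y e) y)"

text \<open>In the following definitions, \<open>h\<close> and \<open>g\<close> are the constraint functions for one fixed
  parameter; their indices range over \<open>{1..m}\<close> and \<open>{1..l}\<close>.\<close>

definition feasible_set ::
  "nat \<Rightarrow> nat \<Rightarrow> (nat \<Rightarrow> 'a \<Rightarrow> real) \<Rightarrow> (nat \<Rightarrow> 'a \<Rightarrow> real) \<Rightarrow> 'a set" where
  "feasible_set m l h g = {y. (\<forall>j\<in>{1..l}. g j y \<le> 0) \<and> (\<forall>i\<in>{1..m}. h i y = 0)}"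

text \<open>The disjoint sum of the index sets forms the joint family of equality and active
  inequality gradients.\<close>
definition LICQ_at ::
  "nat \<Rightarrow> nat \<Rightarrow> (nat \<Rightarrow> 'a::real_inner \<Rightarrow> real) \<Rightarrow> (nat \<Rightarrow> 'a \<Rightarrow> real) \<Rightarrow> 'a \<Rightarrow> bool" where
  "LICQ_at m l h g y \<longleftrightarrow>
     independent_family ({1..m} <+> {j\<in>{1..l}. g j y = 0})
       (case_sum (\<lambda>i. gradient (h i) y) (\<lambda>j. gradient (g j) y))"

text \<open>The spectral norm of the Jacobian of \<open>(g 1, \<dots>, g l)\<close> at \<open>y\<close>. It is written out as a
  supremum over the unit ball because \<open>l\<close> is a number, so the codomain is not a type to which
  \<open>onorm\<close> applies.\<close>
definition jacobian_norm :: "nat \<Rightarrow> (nat \<Rightarrow> 'a::real_inner \<Rightarrow> real) \<Rightarrow> 'a \<Rightarrow> real" where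
  "jacobian_norm l g y = (SUP d\<in>cball 0 1. L2_set (\<lambda>j. gradient (g j) y \<bullet> d) {1..l})"

definition penalty_directions ::
  "nat \<Rightarrow> (nat \<Rightarrow> 'a::real_inner \<Rightarrow> real) \<Rightarrow> 'a \<Rightarrow> 'a set" where
  "penalty_directions m h y =
     {d. norm d \<le> 1 \<and> (\<forall>i\<in>{1..m}. d \<bullet> gradient (h i) y = 0)}"

definition penalty_objective ::
  "nat \<Rightarrow> real \<Rightarrow> (nat \<Rightarrow> real) \<Rightarrow> ('a::real_inner \<Rightarrow> real) \<Rightarrow> (nat \<Rightarrow> 'a \<Rightarrow> real) \<Rightarrow> 'a \<Rightarrow> 'a \<Rightarrow> real" where
  "penalty_objective l M c f g y d =
     gradient f y \<bullet> d + (\<Sum>j=1..l. c j * max (d \<bullet> gradient (g j) y) (- M * g j y))"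

definition linearized_directions ::
  "nat \<Rightarrow> nat \<Rightarrow> real \<Rightarrow> (nat \<Rightarrow> 'a::real_inner \<Rightarrow> real) \<Rightarrow> (nat \<Rightarrow> 'a \<Rightarrow> real) \<Rightarrow> 'a \<Rightarrow> 'a set" where
  "linearized_directions m l M h g y =
     {d. norm d \<le> 1 \<and> (\<forall>i\<in>{1..m}. gradient (h i) y \<bullet> d = 0)
         \<and> (\<forall>j\<in>{1..l}. gradient (g j) y \<bullet> d \<le> - M * g j y)}"

end

theory Submission
  imports Defs
begin

text \<open>
  At every feasible point each constraint either vanishes or is at most \<open>-\<delta>g\<close>, so the set of
  feasible points where \<open>g j\<close> is active is open and closed in \<open>C x\<close>. If it were nonempty, a
  minimizer of \<open>f\<close> on it would be a local minimizer on \<open>C x\<close>, and LICQ there would give a nearby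
  feasible point with \<open>g j\<close> slightly negative, against the gap. Hence no constraint is active at any
  feasible point, and all right-hand sides \<open>-M * g j y\<close> are at least \<open>M * \<delta>g\<close>. If a minimizer \<open>d\<close>
  violated the \<open>j\<close>-th linearized constraint, then shrinking \<open>d\<close> until that constraint is tight would
  raise no penalty term and lower the \<open>j\<close>-th by more than the linear part can increase. So \<open>d\<close> is
  feasible for the linearized problem, on which the penalty is constant.
\<close>

section \<open>Gradients and local surjectivity of functions with independent gradients\<close>

text \<open>The vector representing the derivative is assembled from its values on
  \<open>Basis\<close>; uniqueness of derivatives makes it the one that the description in
  \<open>gradient\<close> picks.\<close>

lemma has_derivative_gradient:
  fixes f :: "'a::euclidean_space \<Rightarrow> real"
  assumes "f differentiable (at y)"
  shows "(f has_derivative (\<lambda>d. gradient f y \<bullet> d)) (at y)"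
proof -
  obtain f' where f': "(f has_derivative f') (at y)"
    using assms by (auto simp: differentiable_def)
  interpret bounded_linear f' by (rule has_derivative_bounded_linear[OF f'])
  define D where "D = (\<Sum>b\<in>Basis. f' b *\<^sub>R b)"
  have f'_eq: "f' d = d \<bullet> D" for d
  proof -
    have "f' d = f' (\<Sum>b\<in>Basis. (d \<bullet> b) *\<^sub>R b)" by (simp add: euclidean_representation)
    also have "\<dots> = d \<bullet> D" by (simp add: sum scaleR D_def inner_sum_right mult.commute)
    finally show ?thesis .
  qed
  have "f' = (\<lambda>d. d \<bullet> D)" using f'_eq by (rule ext)
  with f' have D: "GDERIV f y :> D" by (simp add: gderiv_def)
  have "gradient f y = D"
    unfolding gradient_def
  proof (rule the_equality)
    show "GDERIV f y :> D" by (rule D)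
  next
    fix E assume "GDERIV f y :> E"
    with D have "(\<lambda>d. d \<bullet> D) = (\<lambda>d. d \<bullet> E)"
      unfolding gderiv_def by (rule has_derivative_unique)
    then show "E = D" by (metis inner_commute vector_eq_ldot)
  qed
  with D show ?thesis by (simp add: gderiv_def inner_commute)
qed

text \<open>The coordinate functions \<open>F i\<close> are completed by linear ones to a map of the whole space whose
  derivative at \<open>z\<close> is invertible, so the open mapping theorem can be applied without naming a
  codomain of dimension \<open>card I\<close>.\<close>
lemma independent_gradients_locally_surj:
  fixes F :: "'i \<Rightarrow> 'a::euclidean_space \<Rightarrow> real" and \<tau> :: "'i \<Rightarrow> real"
  assumes diff: "\<And>i y. i \<in> I \<Longrightarrow> F i differentiable (at y)"
    and indep: "independent_family I (\<lambda>i. gradient (F i) z)"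
    and "e > 0"
  shows "\<exists>r>0. \<forall>s. \<bar>s\<bar> < r \<longrightarrow> (\<exists>y\<in>ball z e. \<forall>i\<in>I. F i y = F i z + s * \<tau> i)"
proof -
  define v where "v = (\<lambda>i. gradient (F i) z)"
  have inj: "inj_on v I" and "independent (v ` I)"
    using indep by (auto simp: independent_family_def v_def)
  then obtain B where B: "v ` I \<subseteq> B" "independent B" "UNIV \<subseteq> span B"
    using maximal_independent_subset_extend[of "v ` I" UNIV] by auto
  have finB: "finite B" using B(2) by (rule independent_imp_finite)
  \<comment> \<open>Both branches are chosen so that the gradient of \<open>H b\<close> at
    \<open>z\<close> is \<open>b\<close> itself.\<close>
  define H where "H b y = (if b \<in> v ` I then F (inv_into I v b) y else b \<bullet> y)" for b y
  \<comment> \<open>The value 0 keeps the completing coordinates unchanged under the prescribed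
    displacement.\<close>
  define K where "K b = (if b \<in> v ` I then \<tau> (inv_into I v b) else 0)" for b
  \<comment> \<open>Recombining the coordinates along the same basis \<open>B\<close> gives a
    self-map of the space whose derivative at \<open>z\<close> is the sum of the rank-one maps
    \<open>b b^T\<close>.\<close>
  define G where "G y = (\<Sum>b\<in>B. H b y *\<^sub>R b)" for y
  define G' where "G' d = (\<Sum>b\<in>B. (b \<bullet> d) *\<^sub>R b)" for d
  have H_v: "H (v i) = F i" "K (v i) = \<tau> i" if "i \<in> I" for i
    using that inj by (auto simp: H_def K_def)
  have "H b differentiable (at y)" for b y
    unfolding H_def by (cases "b \<in> v ` I") (auto intro!: diff inv_into_into)
  then have "isCont (H b) y" for b y
    by (rule differentiable_imp_continuous_within)
  then have contG: "continuous_on UNIV G"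
    unfolding G_def by (intro continuous_at_imp_continuous_on ballI continuous_intros) auto
  have "(H b has_derivative (\<lambda>d. b \<bullet> d)) (at z)" for b
  proof (cases "b \<in> v ` I")
    case True
    then obtain i where i: "i \<in> I" "b = v i" by auto
    show ?thesis
      using has_derivative_gradient[OF diff[OF i(1)], of z] H_v(1)[OF i(1)] i(2)
      by (simp add: v_def)
  next
    case False
    then show ?thesis
      unfolding H_def by (auto intro!: derivative_eq_intros)
  qed
  then have derG: "(G has_derivative G') (at z)"
    unfolding G_def G'_def by (auto intro!: derivative_intros)
  have linG': "linear G'"
    using derG has_derivative_linear by blast
  \<comment> \<open>\<open>G' d \<bullet> d\<close> is a sum of squares, so a kernel vector is
    orthogonal to the spanning set \<open>B\<close>.\<close>
  have "inj G'"
    unfolding linear_injective_0[OF linG']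
  proof (intro allI impI)
    fix d assume "G' d = 0"
    then have "0 = G' d \<bullet> d" by simp
    also have "\<dots> = (\<Sum>b\<in>B. (b \<bullet> d)\<^sup>2)"
      by (simp add: G'_def inner_sum_left power2_eq_square)
    finally have "\<forall>b\<in>B. b \<bullet> d = 0"
      using finB by (simp add: sum_nonneg_eq_0_iff)
    then have "orthogonal d x" for x
      using B(3) by (intro orthogonal_to_span[of x B]) (auto simp: orthogonal_def inner_commute)
    then show "d = 0" by (metis orthogonal_self)
  qed
  then obtain g' where g': "linear g'" "G' \<circ> g' = id"
    using linear_injective_isomorphism[OF linG'] by (auto simp: fun_eq_iff)
  \<comment> \<open>This form of the open mapping theorem asks for continuity of \<open>G\<close>,
    but for a derivative with a right inverse only at \<open>z\<close>.\<close>
  have "G z \<in> interior (G ` ball z e)"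
    using sussmann_open_mapping[OF open_UNIV contG UNIV_I derG, of g' "ball z e"] g' \<open>e > 0\<close>
    by (simp add: linear_conv_bounded_linear interior_open)
  then obtain q where q: "q > 0" "ball (G z) q \<subseteq> G ` ball z e"
    using mem_interior by blast
  define w where "w = (\<Sum>b\<in>B. K b *\<^sub>R b)"
  show ?thesis
  \<comment> \<open>The summand 1 keeps the denominator positive when \<open>w = 0\<close>.\<close>
  proof (intro exI[of _ "q / (norm w + 1)"] conjI allI impI)
    show "q / (norm w + 1) > 0" using q by (simp add: add_nonneg_pos)
  next
    fix s :: real assume s: "\<bar>s\<bar> < q / (norm w + 1)"
    have "\<bar>s\<bar> * norm w \<le> \<bar>s\<bar> * (norm w + 1)" by (simp add: mult_left_mono)
    also have "\<dots> < q" using s by (simp add: pos_less_divide_eq add_nonneg_pos)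
    finally have "G z + s *\<^sub>R w \<in> ball (G z) q" by (simp add: dist_norm)
    then obtain y where y: "y \<in> ball z e" "G y = G z + s *\<^sub>R w"
      using q(2) by (metis imageE subsetD)
    from y(2) have "(\<Sum>b\<in>B. (H b y - H b z - s * K b) *\<^sub>R b) = 0"
      by (simp add: G_def w_def scaleR_left_diff_distrib sum_subtractf scaleR_sum_right)
    \<comment> \<open>Independence of \<open>B\<close> turns the vector equation into one equation
      per coordinate.\<close>
    then have eq: "H b y - H b z - s * K b = 0" if "b \<in> B" for b
      using independentD[OF B(2) finB order_refl, of "\<lambda>b. H b y - H b z - s * K b" b] that by simp
    have "F i y = F i z + s * \<tau> i" if "i \<in> I" for i
      using eq[of "v i"] B(1) that H_v by auto
    with y(1) show "\<exists>y\<in>ball z e. \<forall>i\<in>I. F i y = F i z + s * \<tau> i" by blast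
  qed
qed

section \<open>Perturbation into the interior and absence of active constraints\<close>

text \<open>By local surjectivity the equality constraints can be kept at 0 while all active
  inequalities are lowered by one common small amount; the inactive ones stay negative close to
  \<open>z\<close> by continuity.\<close>

lemma LICQ_imp_nearby_strictly_feasible:
  fixes h g :: "nat \<Rightarrow> 'a::euclidean_space \<Rightarrow> real"
  assumes z: "z \<in> feasible_set m l h g"
    and licq: "LICQ_at m l h g z"
    and h: "\<And>i y. i \<in> {1..m} \<Longrightarrow> h i differentiable (at y)"
    and g: "\<And>j y. j \<in> {1..l} \<Longrightarrow> g j differentiable (at y)"
    and "\<delta> > 0"
  shows "\<exists>y\<in>feasible_set m l h g. \<forall>j\<in>{1..l}. g j z = 0 \<longrightarrow> - \<delta> < g j y \<and> g j y < 0"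
proof -
  let ?A = "{j \<in> {1..l}. g j z = 0}"
  have "\<forall>\<^sub>F y in nhds z. g j y < 0" if "j \<in> {1..l} - ?A" for j
  proof -
    have "g j z < 0" using that z by (simp add: feasible_set_def order.strict_iff_order)
    moreover have "(g j \<longlongrightarrow> g j z) (nhds z)"
      using differentiable_imp_continuous_within[OF g, of j z] that
      by (simp add: isCont_def tendsto_at_iff_tendsto_nhds)
    ultimately show ?thesis by (simp add: order_tendstoD)
  qed
  then have "\<forall>\<^sub>F y in nhds z. \<forall>j\<in>{1..l} - ?A. g j y < 0"
    by (simp add: eventually_ball_finite_distrib)
  then obtain e where e: "e > 0" "\<And>y j. dist y z < e \<Longrightarrow> j \<in> {1..l} - ?A \<Longrightarrow> g j y < 0"
    by (auto simp: eventually_nhds_metric)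
  have grad: "(\<lambda>i. gradient (case_sum h g i) z) =
      case_sum (\<lambda>i. gradient (h i) z) (\<lambda>j. gradient (g j) z)"
    by (auto simp: fun_eq_iff split: sum.split)
  have ind: "independent_family ({1..m} <+> ?A) (\<lambda>i. gradient (case_sum h g i) z)"
    using licq by (simp only: LICQ_at_def grad)
  have diff: "case_sum h g i differentiable (at y)" if "i \<in> {1..m} <+> ?A" for i y
    using that h g by (auto simp: Plus_def)
  obtain r where r: "r > 0"
    "\<And>s. \<bar>s\<bar> < r \<Longrightarrow> \<exists>y\<in>ball z e. \<forall>i\<in>{1..m} <+> ?A.
        case_sum h g i y = case_sum h g i z + s * case_sum (\<lambda>_. 0) (\<lambda>_. - 1) i"
    using independent_gradients_locally_surj[OF diff ind e(1), of "case_sum (\<lambda>_. 0) (\<lambda>_. - 1)"]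
    by blast
  \<comment> \<open>Halving the minimum makes \<open>s\<close> strictly smaller than both
    \<open>r\<close>, the range of admissible displacements, and \<delta>.\<close>
  define s where "s = min r \<delta> / 2"
  have s: "0 < s" "\<bar>s\<bar> < r" "s < \<delta>" using r(1) \<open>\<delta> > 0\<close> by (auto simp: s_def min_def)
  obtain y where y: "y \<in> ball z e"
    and eq: "\<forall>i\<in>{1..m} <+> ?A.
        case_sum h g i y = case_sum h g i z + s * case_sum (\<lambda>_. 0) (\<lambda>_. - 1) i"
    using r(2)[OF s(2)] by blast
  have hy: "h i y = 0" if "i \<in> {1..m}" for i
    using eq[rule_format, OF InlI[OF that]] z that by (simp add: feasible_set_def)
  have gy: "g j y = - s" if "j \<in> ?A" for j
    using eq[rule_format, OF InrI[OF that]] that by simp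
  have "g j y \<le> 0" if "j \<in> {1..l}" for j
    using gy[of j] e(2)[of y j] y s(1) that
    by (cases "j \<in> ?A") (auto simp: dist_commute less_imp_le)
  then show ?thesis
    using hy gy s by (intro bexI[of _ y]) (auto simp: feasible_set_def)
qed

lemma no_active_constraint:
  fixes h g :: "nat \<Rightarrow> 'a::euclidean_space \<Rightarrow> real" and m l :: nat
  defines "C \<equiv> feasible_set m l h g"
  assumes "compact C"
    and f: "continuous_on UNIV f"
    and h: "\<And>i y. i \<in> {1..m} \<Longrightarrow> h i differentiable (at y)"
    and g: "\<And>j y. j \<in> {1..l} \<Longrightarrow> g j differentiable (at y)"
    and licq: "\<And>y. local_minimizer f C y \<Longrightarrow> LICQ_at m l h g y"
    and "\<delta> > 0"
    and gap: "\<And>y j. y \<in> C \<Longrightarrow> j \<in> {1..l} \<Longrightarrow> g j y < 0 \<Longrightarrow> g j y \<le> - \<delta>"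
    and y: "y \<in> C" and j: "j \<in> {1..l}"
  shows "g j y < 0"
proof (rule ccontr)
  assume "\<not> g j y < 0"
  with y j have yj: "g j y = 0" by (simp add: C_def feasible_set_def order.strict_iff_order)
  let ?S = "{z \<in> C. g j z = 0}"
  have contg: "isCont (g j) z" for z
    using g[OF j] by (rule differentiable_imp_continuous_within)
  then have "continuous_on UNIV (g j)" by (simp add: continuous_at_imp_continuous_on)
  then have "closed {z. g j z = 0}"
    by (intro closed_Collect_eq continuous_on_const)
  then have "compact (C \<inter> {z. g j z = 0})" by (rule compact_Int_closed[OF \<open>compact C\<close>])
  then have "compact ?S" by (simp add: Int_def)
  moreover have "?S \<noteq> {}" using y yj by blast
  ultimately obtain z where z: "z \<in> ?S" "\<And>u. u \<in> ?S \<Longrightarrow> f z \<le> f u"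
    using continuous_attains_inf[of ?S f] continuous_on_subset[OF f subset_UNIV] by blast
  have "\<forall>\<^sub>F u in nhds z. - \<delta> < g j u"
  proof -
    have "(g j \<longlongrightarrow> g j z) (nhds z)"
      using contg[of z] by (simp add: isCont_def tendsto_at_iff_tendsto_nhds)
    then show ?thesis using z(1) \<open>\<delta> > 0\<close> by (intro order_tendstoD(1)[of _ "g j z"]) auto
  qed
  then obtain e where e: "e > 0" "\<And>u. dist u z < e \<Longrightarrow> - \<delta> < g j u"
    by (auto simp: eventually_nhds_metric)
  \<comment> \<open>Near \<open>z\<close> continuity keeps \<open>g j\<close> above -\<delta>, and
    the gap then leaves only the value 0. So the minimum over \<open>?S\<close> is a local minimum
    over all of \<open>C\<close>.\<close>
  have "u \<in> ?S" if "u \<in> C \<inter> ball z e" for u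
  proof -
    have "\<not> g j u < 0" using gap[of u j] e(2)[of u] that j by (auto simp: dist_commute)
    then show ?thesis using that j by (simp add: C_def feasible_set_def order.strict_iff_order)
  qed
  then have "local_minimizer f C z"
    unfolding local_minimizer_def is_arg_min_linorder using z e(1) by auto
  then have "LICQ_at m l h g z" by (rule licq)
  moreover have "z \<in> feasible_set m l h g" using z(1) by (simp add: C_def)
  ultimately have "\<exists>u\<in>C. \<forall>j\<in>{1..l}. g j z = 0 \<longrightarrow> - \<delta> < g j u \<and> g j u < 0"
    unfolding C_def using h g \<open>\<delta> > 0\<close> by (intro LICQ_imp_nearby_strictly_feasible)
  then obtain u where "u \<in> C" "- \<delta> < g j u" "g j u < 0" using z(1) j by auto
  then show False using gap[of u j] j by simp
qed

section \<open>Exactness of the penalty when all constraints are inactive\<close>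

text \<open>Passing from \<open>d\<close> to \<open>t *\<^sub>R d\<close> lowers the
  \<open>j\<close>-th penalty term by \<open>c j * (1 - t) * s j\<close> and raises the linear part
  by at most \<open>(1 - t) * L\<close>. Since \<open>s j\<close> exceeds
  \<open>M * \<delta>\<close>, the bound on \<open>c j\<close> makes the saving larger.\<close>

lemma penalty_minimizer_satisfies_linearized:
  assumes gy: "\<And>j. j \<in> {1..l} \<Longrightarrow> g j y \<le> - \<delta>"
    and "\<delta> > 0" "M > 0"
    and a: "norm (gradient f y) \<le> L"
    and c: "\<And>j. j \<in> {1..l} \<Longrightarrow> c j > 0" "\<And>j. j \<in> {1..l} \<Longrightarrow> c j > L / (M * \<delta>)"
    and min: "is_arg_min (penalty_objective l M c f g y) (\<lambda>d. d \<in> penalty_directions m h y) d"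
    and j: "j \<in> {1..l}"
  shows "d \<bullet> gradient (g j) y \<le> - M * g j y"
proof (rule ccontr)
  define s where "s = (\<lambda>i. d \<bullet> gradient (g i) y)"
  define \<rho> where "\<rho> = (\<lambda>i. - M * g i y)"
  define \<phi> where "\<phi> = penalty_objective l M c f g y"
  assume "\<not> d \<bullet> gradient (g j) y \<le> - M * g j y"
  then have sj: "s j > \<rho> j" by (simp add: s_def \<rho>_def)
  have \<rho>: "\<rho> i \<ge> M * \<delta>" if "i \<in> {1..l}" for i
    using mult_left_mono[of \<delta> "- g i y" M] gy[OF that] \<open>M > 0\<close> by (simp add: \<rho>_def)
  have M\<delta>: "M * \<delta> > 0" using \<open>M > 0\<close> \<open>\<delta> > 0\<close> by simp
  have \<rho>0: "\<rho> i > 0" if "i \<in> {1..l}" for i using \<rho>[OF that] M\<delta> by linarith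
  have d: "d \<in> penalty_directions m h y" using min by (simp add: is_arg_min_def)
  then have nd: "norm d \<le> 1" by (simp add: penalty_directions_def)
  \<comment> \<open>The factor at which the violated constraint becomes tight; it lies in (0,1)
    because 0 < \<rho> \<open>j\<close> < \<open>s j\<close>.\<close>
  define t where "t = \<rho> j / s j"
  have t: "0 < t" "t < 1" "t * s j = \<rho> j"
    using \<rho>0[OF j] sj by (auto simp: t_def)
  have "norm (t *\<^sub>R d) \<le> 1"
    using t nd by (simp add: mult_le_one)
  then have td: "t *\<^sub>R d \<in> penalty_directions m h y"
    using d by (auto simp: penalty_directions_def)
  \<comment> \<open>Positivity of every \<rho> \<open>i\<close> matters here: shrinking raises a
    negative \<open>s i\<close>, but only to a value still below \<rho> \<open>i\<close>.\<close>
  have shrink: "c i * max (t * s i) (\<rho> i) \<le> c i * max (s i) (\<rho> i)" if "i \<in> {1..l}" for i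
  proof -
    have "t * s i \<le> max (s i) (\<rho> i)"
    proof (cases "s i \<ge> 0")
      case True
      then have "t * s i \<le> s i" using t by (simp add: mult_left_le_one_le)
      then show ?thesis by simp
    next
      case False
      then have "t * s i < 0" using t by (simp add: mult_pos_neg)
      then show ?thesis using \<rho>0[OF that] by linarith
    qed
    then show ?thesis using c(1)[OF that] by (simp add: mult_left_mono)
  qed
  have "(\<Sum>i=1..l. c i * max (t * s i) (\<rho> i)) + c j * (s j - \<rho> j)
      \<le> (\<Sum>i=1..l. c i * max (s i) (\<rho> i))"
  proof -
    have "c j * max (t * s j) (\<rho> j) + c j * (s j - \<rho> j) = c j * max (s j) (\<rho> j)"
      using t(3) sj by (simp add: algebra_simps)
    moreover have "(\<Sum>i\<in>{1..l} - {j}. c i * max (t * s i) (\<rho> i))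
        \<le> (\<Sum>i\<in>{1..l} - {j}. c i * max (s i) (\<rho> i))"
      by (rule sum_mono) (use shrink in auto)
    ultimately show ?thesis using j by (simp add: sum.remove[of _ j])
  qed
  moreover have "\<phi> d \<le> \<phi> (t *\<^sub>R d)"
    using min td by (simp add: is_arg_min_linorder \<phi>_def)
  ultimately have "c j * (s j - \<rho> j) \<le> - (1 - t) * (gradient f y \<bullet> d)"
    by (simp add: \<phi>_def penalty_objective_def s_def \<rho>_def algebra_simps)
  also have "\<dots> \<le> (1 - t) * L"
  proof -
    have "- (gradient f y \<bullet> d) \<le> norm (gradient f y) * norm d"
      using Cauchy_Schwarz_ineq2[of "gradient f y" d] by linarith
    also have "\<dots> \<le> L" using a nd by (metis mult_left_le norm_ge_zero order_trans)
    finally have "(1 - t) * - (gradient f y \<bullet> d) \<le> (1 - t) * L"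
      using t by (intro mult_left_mono) auto
    then show ?thesis by (simp only: mult_minus_left mult_minus_right)
  qed
  \<comment> \<open>Tightness gives \<open>s j - \<rho> j = (1 - t) * s j\<close>, so the factor
    \<open>1 - t\<close> cancels next.\<close>
  finally have "(1 - t) * (c j * s j) \<le> (1 - t) * L"
    using t(3) by (simp add: algebra_simps)
  then have "c j * s j \<le> L" using t by simp
  moreover have "L < c j * (M * \<delta>)" using c(2)[OF j] M\<delta> by (simp add: pos_divide_less_eq)
  moreover have "c j * (M * \<delta>) \<le> c j * s j"
    using \<rho>[OF j] sj c(1)[OF j] by (intro mult_left_mono) auto
  ultimately show False by linarith
qed

text \<open>On \<open>linearized_directions\<close>, a subset of \<open>penalty_directions\<close>,
  each \<open>max\<close> equals its second argument, so the two objectives differ there by a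
  constant.\<close>

lemma penalty_minimizer_optimal_if_feasible:
  assumes min: "is_arg_min (penalty_objective l M c f g y) (\<lambda>d. d \<in> penalty_directions m h y) d"
    and d: "\<And>j. j \<in> {1..l} \<Longrightarrow> d \<bullet> gradient (g j) y \<le> - M * g j y"
  shows "is_arg_min (\<lambda>d. gradient f y \<bullet> d) (\<lambda>d. d \<in> linearized_directions m l M h g y) d"
proof -
  have lin: "u \<in> linearized_directions m l M h g y \<longleftrightarrow> u \<in> penalty_directions m h y \<and>
      (\<forall>j\<in>{1..l}. u \<bullet> gradient (g j) y \<le> - M * g j y)" for u
    by (auto simp: linearized_directions_def penalty_directions_def inner_commute)
  have obj: "penalty_objective l M c f g y u = gradient f y \<bullet> u + (\<Sum>j=1..l. c j * (- M * g j y))"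
    if "u \<in> linearized_directions m l M h g y" for u
    using that unfolding penalty_objective_def lin by (simp add: max_absorb2)
  have dl: "d \<in> linearized_directions m l M h g y"
    using min d by (simp add: lin is_arg_min_def)
  moreover have "gradient f y \<bullet> d \<le> gradient f y \<bullet> u"
    if u: "u \<in> linearized_directions m l M h g y" for u
  proof -
    have "penalty_objective l M c f g y d \<le> penalty_objective l M c f g y u"
      using min u by (simp add: is_arg_min_linorder lin)
    then show ?thesis by (simp add: obj dl u)
  qed
  ultimately show ?thesis by (simp add: is_arg_min_linorder)
qed

section \<open>Exactness uniformly over parameters and feasible points\<close>

theorem lemma1:
  fixes X :: "(real ^ 'p) set" and Y :: "(real ^ 'n) set"
    and m l :: nat
    and f :: "real ^ 'p \<Rightarrow> real ^ 'n \<Rightarrow> real"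
    and h g :: "real ^ 'p \<Rightarrow> nat \<Rightarrow> real ^ 'n \<Rightarrow> real"
    and y0 :: "real ^ 'p \<Rightarrow> real ^ 'n"
    and C :: "real ^ 'p \<Rightarrow> (real ^ 'n) set"
    and Lf Lg \<delta>g M :: real and c :: "nat \<Rightarrow> real"
  defines "C \<equiv> \<lambda>x. feasible_set m l (h x) (g x)"
  assumes "compact X"
    and C_closed: "\<And>x. x \<in> X \<Longrightarrow> C x \<noteq> {} \<and> closed (C x)"
    and y0_feasible: "\<And>x. x \<in> X \<Longrightarrow> y0 x \<in> C x"
    and sublevel_bounded: "\<And>x. x \<in> X \<Longrightarrow> bounded {y \<in> C x. f x y \<le> f x (y0 x)}"
    and h_independent: "\<And>x y. x \<in> X \<Longrightarrow> y \<in> C x \<Longrightarrow>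
          independent_family {1..m} (\<lambda>i. gradient (h x i) y)"
    and LICQ: "\<And>x y. x \<in> X \<Longrightarrow> local_minimizer (f x) (C x) y \<Longrightarrow> LICQ_at m l (h x) (g x) y"
    and Y_compact: "compact Y"
    and C_subset_Y: "\<And>x. x \<in> X \<Longrightarrow> C x \<subseteq> Y"
    and f_C1: "\<And>x. x \<in> X \<Longrightarrow> continuously_differentiable (f x)"
    and h_C1: "\<And>x i. x \<in> X \<Longrightarrow> i \<in> {1..m} \<Longrightarrow> continuously_differentiable (h x i)"
    and g_C1: "\<And>x j. x \<in> X \<Longrightarrow> j \<in> {1..l} \<Longrightarrow> continuously_differentiable (g x j)"
    and grad_f_cont: "continuous_on (X \<times> Y) (\<lambda>(x, y). gradient (f x) y)"
    and grad_g_cont: "\<And>j. j \<in> {1..l} \<Longrightarrow> continuous_on (X \<times> Y) (\<lambda>(x, y). gradient (g x j) y)"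
    and "Lf > 0" and "Lg > 0"
    and Lf_bound: "\<And>x y. x \<in> X \<Longrightarrow> y \<in> C x \<Longrightarrow> norm (gradient (f x) y) \<le> Lf"
    and Lg_bound: "\<And>x y. x \<in> X \<Longrightarrow> y \<in> C x \<Longrightarrow> jacobian_norm l (g x) y \<le> Lg"
    and "\<delta>g > 0"
    and slack_gap: "\<And>x y. x \<in> X \<Longrightarrow> y \<in> C x \<Longrightarrow>
          ereal \<delta>g \<le> (INF j\<in>{j\<in>{1..l}. g x j y < 0}. ereal (- g x j y))"
    and "M > 0"
    and c_pos: "\<And>j. j \<in> {1..l} \<Longrightarrow> c j > 0"
    and c_min: "Min (c ` {1..l}) > Lf / (M * \<delta>g)"
  shows "\<forall>x\<in>X. \<forall>y\<in>C x. \<forall>d.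
           is_arg_min (penalty_objective l M c (f x) (g x) y)
             (\<lambda>d. d \<in> penalty_directions m (h x) y) d
           \<longrightarrow> is_arg_min (\<lambda>d. gradient (f x) y \<bullet> d)
             (\<lambda>d. d \<in> linearized_directions m l M (h x) (g x) y) d"
proof (intro ballI allI impI)
  fix x y d
  assume x: "x \<in> X" and y: "y \<in> C x"
    and min: "is_arg_min (penalty_objective l M c (f x) (g x) y)
      (\<lambda>d. d \<in> penalty_directions m (h x) y) d"
  \<comment> \<open>The infimum over the negative constraints bounds each of them; this pointwise
    form is needed at all feasible points, not just at \<open>y\<close>.\<close>
  have gap: "g x j u \<le> - \<delta>g" if "u \<in> C x" "j \<in> {1..l}" "g x j u < 0" for u j
  proof -
    have "ereal \<delta>g \<le> ereal (- g x j u)"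
      using slack_gap[OF x that(1)] that(2,3) by (elim order_trans) (auto intro: INF_lower2)
    then show ?thesis by simp
  qed
  have comp: "compact (C x)"
    using C_closed[OF x] C_subset_Y[OF x] Y_compact
    by (metis compact_Int_closed inf.absorb_iff2)
  have diff: "f x differentiable (at u)"
    "i \<in> {1..m} \<Longrightarrow> h x i differentiable (at u)"
    "j \<in> {1..l} \<Longrightarrow> g x j differentiable (at u)" for u i j
    using f_C1[OF x] h_C1[OF x] g_C1[OF x] by (auto simp: continuously_differentiable_def)
  have contf: "continuous_on UNIV (f x)"
    by (intro continuous_at_imp_continuous_on ballI differentiable_imp_continuous_within diff)
  have Cx: "C x = feasible_set m l (h x) (g x)" by (simp add: C_def)
  have inactive: "g x j y < 0" if "j \<in> {1..l}" for j
    by (rule no_active_constraint[of m l "h x" "g x" "f x" \<delta>g y j, folded Cx,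
          OF comp contf diff(2,3) LICQ[OF x] \<open>\<delta>g > 0\<close> gap y that])
  have gy: "g x j y \<le> - \<delta>g" if "j \<in> {1..l}" for j
    using gap[OF y that inactive[OF that]] .
  \<comment> \<open>The bound is read off only at an index \<open>j\<close> in
    \<open>{1..l}\<close>, so \<open>Min\<close> is never evaluated on an empty set.\<close>
  have c: "c j > Lf / (M * \<delta>g)" if "j \<in> {1..l}" for j
    using c_min Min_le[of "c ` {1..l}" "c j"] that by fastforce
  have "d \<bullet> gradient (g x j) y \<le> - M * g x j y" if "j \<in> {1..l}" for j
    by (rule penalty_minimizer_satisfies_linearized[OF gy \<open>\<delta>g > 0\<close> \<open>M > 0\<close> Lf_bound[OF x y]
          c_pos c min that])
  with min show "is_arg_min (\<lambda>d. gradient (f x) y \<bullet> d)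
      (\<lambda>d. d \<in> linearized_directions m l M (h x) (g x) y) d"
    by (rule penalty_minimizer_optimal_if_feasible)
qed

end
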